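(* Let $w$ be a positive integer, let $p_1(y),\ldots,p_w(y)\in\mathbb{R}[y]$, and let $\mathbb{N}=S_1\cup\cdots\cup S_w$ be a partition of $\mathbb{N}$ with each $1_{S_v}(n)$ deterministic; set $g(n)=\sum_{v=1}^{w}1_{S_v}(n)p_v(n)$. Suppose that $\{f_i(n)\}_{i=0}^{\infty}$ is a sequence of real-valued arithmetic functions such that \[\lim_{n\to\infty}\sup_{i\in\mathbb{N}}\|\triangle^k f_i(n)-g(n)\|=0\] holds for some $k\in\mathbb{N}$. Then for any concatenation $f(n)$ of $\{f_i(n)\}_{i=0}^{\infty}$ (with respect to any admissible sequence $\{N_i\}$), $e(f(n))$ is deterministic.
   Context: $\mathbb{N}=\{0,1,2,\ldots\}$; an arithmetic function is a map $\mathbb{N}\to\mathbb{C}$. An arithmetic function $\xi$ is deterministic if there exist a compact Hausdorff space $\mathcal{X}$, a continuous map $T:\mathcal{X}\to\mathcal{X}$ of zero topological entropy, $x_0\in\mathcal{X}$ and continuous $F:\mathcal{X}\to\mathbb{C}$ with $\xi(n)=F(T^nx_0)$ for all $n$. $e(x)=\exp(2\pi i x)$; $\|x\|$ is the distance from $x$ to the nearest integer; $(\triangle f)(n)=f(n+1)-f(n)$ and $\triangle^k$ is its $k$-fold iterate. Concatenation: given natural numbers $0=N_0<N_1<N_2<\cdots$ with $\lim_{i\to\infty}(N_{i+1}-N_i)=\infty$ and arithmetic functions $f_i$, the concatenation of $\{f_i\}$ with respect to $\{N_i\}$ is the function $f$ with $f(n)=f_i(n)$ for $N_i\le n<N_{i+1}$,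 $i=0,1,\ldots$. *)

theory Defs
  imports "HOL-Analysis.Analysis"
begin

section \<open>Topological entropy via open covers (Adler, Konheim and McAndrew)\<close>

definition open_cover :: "'a topology \<Rightarrow> 'a set set \<Rightarrow> bool" where
  "open_cover X \<U> \<longleftrightarrow> (\<forall>U\<in>\<U>. openin X U) \<and> \<Union>\<U> = topspace X"

definition cover_join :: "'a set set \<Rightarrow> 'a set set \<Rightarrow> 'a set set" where
  "cover_join \<U> \<V> = {U \<inter> V | U V. U \<in> \<U> \<and> V \<in> \<V>}"

definition cover_preimage :: "'a topology \<Rightarrow> ('a \<Rightarrow> 'a) \<Rightarrow> 'a set set \<Rightarrow> 'a set set" where
  "cover_preimage X T \<U> = (\<lambda>U. {x \<in> topspace X. T x \<in> U}) ` \<U>"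

text \<open>The join of the covers pulled back along \<open>T ^^ j\<close> for \<open>j < n\<close>; the empty join is the
  trivial cover.\<close>
primrec iterated_cover ::
  "'a topology \<Rightarrow> ('a \<Rightarrow> 'a) \<Rightarrow> 'a set set \<Rightarrow> nat \<Rightarrow> 'a set set" where
  "iterated_cover X T \<U> 0 = {topspace X}"
| "iterated_cover X T \<U> (Suc n) =
     cover_join (iterated_cover X T \<U> n) (cover_preimage X (T ^^ n) \<U>)"

text \<open>The least cardinality of a finite subcover. On a compact space the set of candidates is
  nonempty for every open cover.\<close>
definition cover_number :: "'a topology \<Rightarrow> 'a set set \<Rightarrow> nat" where
  "cover_number X \<U> = Inf {card \<V> | \<V>. \<V> \<subseteq> \<U> \<and> finite \<V> \<and> \<Union>\<V> = topspace X}"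

text \<open>For continuous \<open>T\<close> on compact \<open>X\<close> the sequence is subadditive before division by \<open>n\<close>, so the
  upper limit is a limit.\<close>
definition cover_entropy :: "'a topology \<Rightarrow> ('a \<Rightarrow> 'a) \<Rightarrow> 'a set set \<Rightarrow> ereal" where
  "cover_entropy X T \<U> =
     limsup (\<lambda>n. ereal (ln (real (cover_number X (iterated_cover X T \<U> n))) / real n))"

definition topological_entropy :: "'a topology \<Rightarrow> ('a \<Rightarrow> 'a) \<Rightarrow> ereal" where
  "topological_entropy X T = (SUP \<U>\<in>{\<U>. open_cover X \<U>}. cover_entropy X T \<U>)"


section \<open>Deterministic arithmetic functions\<close>

text \<open>The existential over all compact Hausdorff spaces cannot range over types, so the type from
  which the points of the space are drawn is a parameter; the points form an arbitrary subset
  (\<open>topspace X\<close>) of it with an arbitrary topology. No generality is lost with the type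
  \<open>nat \<Rightarrow> complex\<close>: if \<open>\<xi> n = F ((T ^^ n) x\<^sub>0)\<close>, then \<open>x \<mapsto> (F ((T ^^ n) x))\<^sub>n\<close> maps \<open>X\<close> onto a
  compact Hausdorff factor inside \<open>nat \<Rightarrow> complex\<close> on which the shift, of no larger entropy,
  realises \<open>\<xi>\<close>.\<close>
definition deterministic :: "'a itself \<Rightarrow> (nat \<Rightarrow> complex) \<Rightarrow> bool" where
  "deterministic (_ :: 'a itself) \<xi> \<longleftrightarrow>
     (\<exists>(X :: 'a topology) T x\<^sub>0 F.
        compact_space X \<and> Hausdorff_space X \<and>
        continuous_map X X T \<and> topological_entropy X T = 0 \<and>
        x\<^sub>0 \<in> topspace X \<and> continuous_map X euclidean F \<and>
        (\<forall>n. \<xi> n = F ((T ^^ n) x\<^sub>0)))"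


section \<open>Differences, distance to the integers, concatenations\<close>

definition e :: "real \<Rightarrow> complex" where
  "e x = exp (2 * of_real pi * \<i> * of_real x)"

definition dist_int :: "real \<Rightarrow> real" where
  "dist_int x = \<bar>x - of_int (round x)\<bar>"

definition fwd_diff :: "(nat \<Rightarrow> real) \<Rightarrow> nat \<Rightarrow> real" where
  "fwd_diff f n = f (n + 1) - f n"

definition admissible_seq :: "(nat \<Rightarrow> nat) \<Rightarrow> bool" where
  "admissible_seq N \<longleftrightarrow>
     N 0 = 0 \<and> strict_mono N \<and> filterlim (\<lambda>i. N (Suc i) - N i) at_top sequentially"

definition is_concatenation ::
  "(nat \<Rightarrow> nat \<Rightarrow> real) \<Rightarrow> (nat \<Rightarrow> nat) \<Rightarrow> (nat \<Rightarrow> real) \<Rightarrow> bool" where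
  "is_concatenation fs N f \<longleftrightarrow> (\<forall>i n. N i \<le> n \<and> n < N (Suc i) \<longrightarrow> f n = fs i n)"

end

theory Submission
  imports Defs
begin

text \<open>A bounded function is deterministic iff, for every precision and every \<open>\<eta> > 0\<close>, its windows of
  length \<open>n\<close> can be told apart at that precision by \<open>O(exp (\<eta> n))\<close> codes. For \<open>e (f n)\<close>, cut a window
  into blocks of a large fixed length \<open>L\<close>. Far out, a block contains at most one breakpoint \<open>N\<^sub>i\<close>; on
  each of the two pieces \<open>f\<close> modulo 1 is determined by \<open>g\<close> modulo 1 and the first \<open>k\<close> differences of
  \<open>f\<close> at the start of the piece, because an error \<open>\<theta>\<close> in these data grows only to \<open>\<theta> L\<^sup>k\<close>. A block thus
  costs \<open>O(ln L)\<close>, which is \<open>o(L)\<close>. The windows of \<open>g\<close> modulo 1 have subexponential complexity: the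
  words of the \<open>S\<^sub>v\<close> do by hypothesis, and the shifted polynomials are determined by finitely many
  coefficients modulo 1, rounded to a precision polynomial in \<open>n\<close>.\<close>

subsection \<open>Distance to the integers\<close>

lemma dist_int_nonneg: "0 \<le> dist_int x"
  by (simp add: dist_int_def)

lemma dist_int_le: "dist_int x \<le> \<bar>x - of_int z\<bar>"
  unfolding dist_int_def by (rule round_diff_minimal)

lemma dist_int_le_half: "dist_int x \<le> 1 / 2"
  unfolding dist_int_def using of_int_round_abs_le[of x] by (simp add: abs_minus_commute)

lemma dist_int_add: "dist_int (x + y) \<le> dist_int x + dist_int y"
  using dist_int_le[of "x + y" "round x + round y"] unfolding dist_int_def by simp

lemma dist_int_uminus [simp]: "dist_int (- x) = dist_int x"
proof -
  have "dist_int (- y) \<le> dist_int y" for y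
    using dist_int_le[of "- y" "- round y"] unfolding dist_int_def by simp
  from this[of x] this[of "- x"] show ?thesis by simp
qed

lemma dist_int_diff: "dist_int (x - y) \<le> dist_int x + dist_int y"
  using dist_int_add[of x "- y"] by simp

lemma dist_int_of_int_mult: "dist_int (of_int z * x) \<le> \<bar>of_int z\<bar> * dist_int x"
  using dist_int_le[of "of_int z * x" "z * round x"]
  by (simp add: dist_int_def flip: abs_mult right_diff_distrib)

lemma dist_int_sum: "dist_int (sum h A) \<le> (\<Sum>a\<in>A. dist_int (h a))"
proof (induction A rule: infinite_finite_induct)
  case (insert a A)
  then show ?case using dist_int_add[of "h a" "sum h A"] by simp
qed (simp_all add: dist_int_def)

text \<open>Rounding acts on the fractional part, so \<open>Q\<close> codes serve all reals at
  precision \<open>1 / Q\<close> modulo 1.\<close>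

definition round_code :: "nat \<Rightarrow> real \<Rightarrow> nat" where
  "round_code Q x = nat \<lfloor>real Q * frac x\<rfloor>"

lemma round_code_less: "0 < Q \<Longrightarrow> round_code Q x < Q"
  unfolding round_code_def using frac_lt_1[of x] frac_ge_0[of x]
  by (simp add: nat_less_iff floor_less_iff)

lemma dist_int_le_of_round_code:
  assumes "0 < Q" "round_code Q x = round_code Q y"
  shows "dist_int (x - y) \<le> 1 / Q"
proof -
  have "\<lfloor>real Q * frac x\<rfloor> = \<lfloor>real Q * frac y\<rfloor>"
    using assms(2) unfolding round_code_def by (simp add: frac_ge_0 eq_nat_nat_iff)
  then have "\<bar>real Q * frac x - real Q * frac y\<bar> \<le> 1" by linarith
  then have "real Q * \<bar>frac x - frac y\<bar> \<le> 1"
    by (simp add: abs_mult flip: right_diff_distrib)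
  then have "\<bar>frac x - frac y\<bar> \<le> 1 / Q"
    using assms(1) by (simp add: field_simps)
  moreover have "dist_int (x - y) \<le> \<bar>frac x - frac y\<bar>"
    using dist_int_le[of "x - y" "\<lfloor>x\<rfloor> - \<lfloor>y\<rfloor>"] by (simp add: frac_def algebra_simps)
  ultimately show ?thesis by linarith
qed

lemma norm_e [simp]: "norm (e x) = 1"
  by (simp add: e_def norm_exp_eq_Re)

text \<open>Since \<open>e\<close> has period 1, \<open>x - y\<close> may be replaced by its residue
  \<open>t\<close> of least modulus; a chord of the unit circle is at most its arc.\<close>

lemma norm_e_diff_le: "norm (e x - e y) \<le> 2 * pi * dist_int (x - y)"
proof -
  define z where "z = round (x - y)"
  define t where "t = x - y - of_int z"
  have ex: "e x = e y * exp (\<i> * of_real (2 * pi * t))"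
  proof -
    have "exp (2 * of_real pi * \<i> * of_real x) =
      exp (2 * of_real pi * \<i> * of_real y + \<i> * of_real (2 * pi * t) + 2 * of_int z * of_real pi * \<i>)"
      by (rule arg_cong[where f = exp]) (simp add: t_def algebra_simps)
    also have "\<dots> = exp (2 * of_real pi * \<i> * of_real y) * exp (\<i> * of_real (2 * pi * t))"
      using exp_integer_2pi[of "of_int z"] by (simp add: exp_add mult.assoc)
    finally show ?thesis unfolding e_def .
  qed
  have "norm (e x - e y) = norm (e y * (exp (\<i> * of_real (2 * pi * t)) - 1))"
    by (simp add: ex algebra_simps)
  also have "\<dots> = norm (exp (\<i> * of_real (2 * pi * t)) - 1)" by (simp add: norm_mult)
  also have "\<dots> \<le> \<bar>2 * pi * t\<bar>"
    using abs_sin_x_le_abs_x[of "pi * t"] dist_exp_i_1[of "2 * pi * t"] by (simp add: abs_mult)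
  also have "\<dots> = 2 * pi * dist_int (x - y)" by (simp add: abs_mult dist_int_def t_def z_def)
  finally show ?thesis .
qed

subsection \<open>Iterated differences\<close>

lemma fwd_diff_funpow_diff:
  "(fwd_diff ^^ k) (\<lambda>j. a j - b j) n = (fwd_diff ^^ k) a n - (fwd_diff ^^ k) b n"
  by (induction k arbitrary: n) (simp_all add: fwd_diff_def)

lemma fwd_diff_funpow_shift: "(fwd_diff ^^ k) (\<lambda>j. a (m + j)) n = (fwd_diff ^^ k) a (m + n)"
  by (induction k arbitrary: n) (simp_all add: fwd_diff_def)

lemma fwd_diff_funpow_cong:
  "(\<And>j. n \<le> j \<Longrightarrow> j \<le> n + k \<Longrightarrow> a j = b j) \<Longrightarrow> (fwd_diff ^^ k) a n = (fwd_diff ^^ k) b n"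
  by (induction k arbitrary: n) (simp_all add: fwd_diff_def)

text \<open>Discrete integration modulo 1: recovering \<open>D\<close> from
  \<open>fwd_diff D\<close> adds up at most \<open>u\<close> errors, so each order costs one factor
  \<open>real u + 1\<close>. Differences of order \<open>k\<close> are controlled only where all the
  values they involve lie before \<open>b\<close>.\<close>

lemma dist_int_le_of_fwd_diff:
  assumes "\<And>i. i < k \<Longrightarrow> dist_int ((fwd_diff ^^ i) D a) \<le> \<theta>"
    and "\<And>j. a \<le> j \<Longrightarrow> j + k < b \<Longrightarrow> dist_int ((fwd_diff ^^ k) D j) \<le> \<theta>"
    and "0 \<le> \<theta>" "a + u < b"
  shows "dist_int (D (a + u)) \<le> \<theta> * (real u + 1) ^ k"
  using assms
proof (induction k arbitrary: D b u)
  case 0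
  then show ?case by simp
next
  case (Suc k)
  \<comment> \<open>A difference at \<open>a + v\<close> involves \<open>a + v + 1\<close>, so the
    window of \<open>fwd_diff D\<close> ends one position earlier.\<close>
  have d: "dist_int (fwd_diff D (a + v)) \<le> \<theta> * (real v + 1) ^ k" if "a + v < b - 1" for v
  proof (rule Suc.IH[where b = "b - 1"])
    show "dist_int ((fwd_diff ^^ i) (fwd_diff D) a) \<le> \<theta>" if "i < k" for i
      using Suc.prems(1)[of "Suc i"] that by (simp add: funpow_swap1)
    show "dist_int ((fwd_diff ^^ k) (fwd_diff D) j) \<le> \<theta>" if "a \<le> j" "j + k < b - 1" for j
      using Suc.prems(2)[of j] that by (simp add: funpow_swap1)
  qed (use Suc.prems that in auto)
  show ?case using Suc.prems(4)
  proof (induction u)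
    case 0
    then show ?case using Suc.prems(1)[of 0] by simp
  next
    case (Suc u)
    have "dist_int (D (a + Suc u)) \<le> dist_int (D (a + u)) + dist_int (fwd_diff D (a + u))"
      using dist_int_add[of "D (a + u)" "fwd_diff D (a + u)"] by (simp add: fwd_diff_def)
    also have "\<dots> \<le> \<theta> * (real u + 1) ^ Suc k + \<theta> * (real u + 1) ^ k"
      using Suc d[of u] by (intro add_mono) auto
    also have "\<dots> = \<theta> * ((real u + 1) ^ k * (real u + 2))" by (simp add: algebra_simps)
    also have "\<dots> \<le> \<theta> * ((real u + 2) ^ k * (real u + 2))"
      using \<open>0 \<le> \<theta>\<close> by (intro mult_left_mono mult_right_mono power_mono) auto
    finally show ?case by (simp add: algebra_simps)
  qed
qed

subsection \<open>Coding windows at an exponential rate\<close>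

text \<open>\<open>R n m m'\<close> is meant to express that the windows of length \<open>n\<close> at \<open>m\<close> and \<open>m'\<close> look alike;
  the value \<open>c m\<close> is a code for the window at \<open>m\<close>.\<close>
definition codable_at_rate :: "real \<Rightarrow> (nat \<Rightarrow> nat \<Rightarrow> nat \<Rightarrow> bool) \<Rightarrow> bool" where
  "codable_at_rate \<eta> R \<longleftrightarrow> (\<exists>C. \<forall>n. \<exists>c :: nat \<Rightarrow> nat.
     finite (range c) \<and> real (card (range c)) \<le> C * exp (\<eta> * real n) \<and>
     (\<forall>m m'. c m = c m' \<longrightarrow> R n m m'))"

lemma codable_at_rateI:
  fixes c :: "nat \<Rightarrow> nat \<Rightarrow> 'b :: countable"
  assumes "\<And>n m. c n m \<in> A n" "\<And>n. finite (A n)"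
    and "\<And>n. real (card (A n)) \<le> C * exp (\<eta> * real n)"
    and "\<And>n m m'. c n m = c n m' \<Longrightarrow> R n m m'"
  shows "codable_at_rate \<eta> R"
  unfolding codable_at_rate_def
proof (intro exI allI conjI)
  fix n
  let ?d = "\<lambda>m. to_nat (c n m)"
  have sub: "range ?d \<subseteq> to_nat ` A n" using assms(1) by auto
  then show "finite (range ?d)" using assms(2) finite_subset by blast
  have "card (range ?d) \<le> card (A n)"
    using sub assms(2) by (meson card_image_le card_mono finite_imageI le_trans)
  then show "real (card (range ?d)) \<le> C * exp (\<eta> * real n)"
    using assms(3)[of n] by linarith
  show "?d m = ?d m' \<longrightarrow> R n m m'" for m m' using assms(4) by simp
qed

text \<open>With pairs as codes the cardinalities multiply, so the rates add.\<close>

lemma codable_at_rate_conj: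
  assumes "codable_at_rate \<eta> R" "codable_at_rate \<eta>' R'"
  shows "codable_at_rate (\<eta> + \<eta>') (\<lambda>n m m'. R n m m' \<and> R' n m m')"
proof -
  obtain C c where c: "\<And>n. finite (range (c n :: nat \<Rightarrow> nat))"
    "\<And>n. real (card (range (c n))) \<le> C * exp (\<eta> * real n)" "\<And>n m m'. c n m = c n m' \<Longrightarrow> R n m m'"
    using assms(1) unfolding codable_at_rate_def by metis
  obtain C' c' where c': "\<And>n. finite (range (c' n :: nat \<Rightarrow> nat))"
    "\<And>n. real (card (range (c' n))) \<le> C' * exp (\<eta>' * real n)" "\<And>n m m'. c' n m = c' n m' \<Longrightarrow> R' n m m'"
    using assms(2) unfolding codable_at_rate_def by metis
  show ?thesis
  proof (rule codable_at_rateI[where c = "\<lambda>n m. (c n m, c' n m)"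
        and A = "\<lambda>n. range (c n) \<times> range (c' n)" and C = "C * C'"])
    fix n
    have "real (card (range (c n) \<times> range (c' n))) = real (card (range (c n))) * real (card (range (c' n)))"
      by (simp add: card_cartesian_product)
    also have "\<dots> \<le> (C * exp (\<eta> * real n)) * (C' * exp (\<eta>' * real n))"
      using c(2)[of n] by (intro mult_mono c c') (auto intro: order_trans[OF of_nat_0_le_iff])
    also have "\<dots> = C * C' * exp ((\<eta> + \<eta>') * real n)"
      by (simp add: exp_add algebra_simps)
    finally show "real (card (range (c n) \<times> range (c' n))) \<le> C * C' * exp ((\<eta> + \<eta>') * real n)" .
  qed (use c c' in auto)
qed

lemma codable_at_rate_mono:
  assumes "codable_at_rate \<eta> R" "\<And>n m m'. R n m m' \<Longrightarrow> R' n m m'"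
  shows "codable_at_rate \<eta> R'"
  using assms unfolding codable_at_rate_def by meson

lemma codable_at_rate_finite_range:
  assumes "finite (range (u :: nat \<Rightarrow> nat))"
  shows "codable_at_rate 0 (\<lambda>n m m'. u m = u m')"
  by (rule codable_at_rateI[where c = "\<lambda>n. u" and A = "\<lambda>n. range u" and C = "card (range u)"])
    (use assms in auto)

text \<open>Appending \<open>min M m\<close> to the code identifies each position below
  \<open>M\<close> individually. This costs only a constant factor, so the rate is
  unaffected.\<close>

lemma codable_at_rate_eventually:
  assumes "codable_at_rate \<eta> (\<lambda>n m m'. M \<le> m \<longrightarrow> M \<le> m' \<longrightarrow> R n m m')" "\<And>n m. R n m m"
  shows "codable_at_rate \<eta> R"
proof -
  have "finite (range (min M))"
    by (rule finite_subset[of _ "{..M}"]) auto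
  from codable_at_rate_conj[OF assms(1) codable_at_rate_finite_range[OF this]]
  have "codable_at_rate \<eta> (\<lambda>n m m'. (M \<le> m \<longrightarrow> M \<le> m' \<longrightarrow> R n m m') \<and> min M m = min M m')"
    by simp
  then show ?thesis
  proof (rule codable_at_rate_mono)
    fix n m m' assume h: "(M \<le> m \<longrightarrow> M \<le> m' \<longrightarrow> R n m m') \<and> min M m = min M m'"
    then have "m = m' \<or> M \<le> m \<and> M \<le> m'" unfolding min_def by (auto split: if_splits)
    with h assms(2) show "R n m m'" by auto
  qed
qed

text \<open>Every positive rate is available for every index, so the finitely many indices can share
  the prescribed rate by repeated halving.\<close>

lemma codable_at_rate_ball:
  assumes "finite I" "\<And>i \<eta>. i \<in> I \<Longrightarrow> 0 < \<eta> \<Longrightarrow> codable_at_rate \<eta> (R i)" "0 < \<eta>"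
  shows "codable_at_rate \<eta> (\<lambda>n m m'. \<forall>i\<in>I. R i n m m')"
  using assms
proof (induction I arbitrary: \<eta> rule: finite_induct)
  case empty
  show ?case
    by (rule codable_at_rateI[where c = "\<lambda>n m. ()" and A = "\<lambda>n. {()}" and C = 1]) (use empty in auto)
next
  case (insert i I)
  have "codable_at_rate (\<eta> / 2 + \<eta> / 2) (\<lambda>n m m'. R i n m m' \<and> (\<forall>i\<in>I. R i n m m'))"
    using insert by (intro codable_at_rate_conj) auto
  then show ?case by simp
qed

text \<open>Precision \<open>\<delta> / n ^ d\<close> modulo 1 takes a number of codes polynomial in
  \<open>n\<close>, which fits every positive exponential rate.\<close>

lemma codable_at_rate_dist_int:
  fixes u :: "nat \<Rightarrow> real"
  assumes "0 < \<delta>" "0 < \<eta>"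
  shows "codable_at_rate \<eta> (\<lambda>n m m'. real n ^ d * dist_int (u m - u m') \<le> \<delta>)"
proof -
  define Q where "Q n = nat \<lceil>real n ^ d / \<delta>\<rceil> + 1" for n :: nat
  have Q: "real n ^ d / \<delta> \<le> Q n" "real (Q n) \<le> real n ^ d / \<delta> + 2" for n
  proof -
    have "0 \<le> real n ^ d / \<delta>" using assms by simp
    then show "real n ^ d / \<delta> \<le> Q n" "real (Q n) \<le> real n ^ d / \<delta> + 2"
      unfolding Q_def by linarith+
  qed
  \<comment> \<open>From \<open>x \<le> exp x\<close> at \<open>x = \<eta> * n / d\<close>, raised
    to the power \<open>d\<close>; the summand 2 absorbs the rounding in \<open>Q\<close>.\<close>
  define C where "C = (real d / \<eta>) ^ d / \<delta> + 2"
  have C: "real n ^ d / \<delta> + 2 \<le> C * exp (\<eta> * real n)" for n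
  proof -
    have "real n ^ d \<le> (real d / \<eta> * exp (\<eta> * real n / real d)) ^ d"
    proof (cases "d = 0")
      case False
      have "\<eta> * real n / real d \<le> exp (\<eta> * real n / real d)"
        using exp_ge_add_one_self[of "\<eta> * real n / real d"] by linarith
      then show ?thesis using False assms by (intro power_mono) (auto simp: field_simps)
    qed simp
    also have "\<dots> = (real d / \<eta>) ^ d * exp (\<eta> * real n / real d) ^ d"
      by (rule power_mult_distrib)
    also have "\<dots> \<le> (real d / \<eta>) ^ d * exp (\<eta> * real n)"
      using assms by (cases "d = 0") (auto simp flip: exp_of_nat_mult)
    finally have "real n ^ d / \<delta> \<le> (real d / \<eta>) ^ d / \<delta> * exp (\<eta> * real n)"
      using assms by (simp add: field_simps)
    moreover have "1 \<le> exp (\<eta> * real n)" using assms by simp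
    ultimately show ?thesis unfolding C_def distrib_right by linarith
  qed
  show ?thesis
  proof (rule codable_at_rateI[where c = "\<lambda>n m. round_code (Q n) (u m)" and A = "\<lambda>n. {..<Q n}" and C = C])
    show "round_code (Q n) (u m) \<in> {..<Q n}" for n m
      by (simp add: round_code_less Q_def)
    show "real (card {..<Q n}) \<le> C * exp (\<eta> * real n)" for n
      using Q(2)[of n] C[of n] by simp
    show "real n ^ d * dist_int (u m - u m') \<le> \<delta>" if "round_code (Q n) (u m) = round_code (Q n) (u m')" for n m m'
    proof -
      have q: "0 < Q n" by (simp add: Q_def)
      have "real n ^ d * dist_int (u m - u m') \<le> real n ^ d * (1 / Q n)"
        by (intro mult_left_mono dist_int_le_of_round_code[OF q that]) auto
      also have "\<dots> \<le> \<delta>" using Q(1)[of n] q assms by (simp add: field_simps)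
      finally show ?thesis .
    qed
  qed auto
qed

text \<open>Expanded about the start \<open>m\<close> of the window, \<open>p\<close> becomes a
  polynomial in the offset \<open>j\<close> with \<open>d + 1\<close> coefficients. Powers of
  \<open>j\<close> are integers, so the coefficients matter only modulo 1, and an error in one of
  them grows at most by \<open>n ^ d\<close>.\<close>

lemma codable_at_rate_poly:
  fixes p :: "real poly"
  assumes "0 < \<delta>" "0 < \<eta>"
  shows "codable_at_rate \<eta> (\<lambda>n m m'. \<forall>j<n.
    dist_int (poly p (real (m + j)) - poly p (real (m' + j))) \<le> \<delta>)"
proof -
  define d where "d = degree p"
  define u where "u r m = coeff (pcompose p [:real m, 1:]) r" for r m
  have taylor: "poly p (real (m + j)) = (\<Sum>r\<le>d. u r m * real j ^ r)" for m j
  proof -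
    have "poly p (real (m + j)) = poly (pcompose p [:real m, 1:]) (real j)"
      by (simp add: poly_pcompose)
    also have "\<dots> = (\<Sum>r\<le>d. u r m * real j ^ r)"
      unfolding poly_altdef u_def d_def by (simp add: degree_pcompose)
    finally show ?thesis .
  qed
  have "codable_at_rate \<eta> (\<lambda>n m m'. \<forall>r\<in>{..d}. real n ^ d * dist_int (u r m - u r m') \<le> \<delta> / real (d + 1))"
    using assms by (intro codable_at_rate_ball codable_at_rate_dist_int) auto
  then show ?thesis
  proof (rule codable_at_rate_mono, intro allI impI)
    fix n m m' j :: nat
    assume h: "\<forall>r\<in>{..d}. real n ^ d * dist_int (u r m - u r m') \<le> \<delta> / real (d + 1)" and j: "j < n"
    have "poly p (real (m + j)) - poly p (real (m' + j)) = (\<Sum>r\<le>d. of_int (int j ^ r) * (u r m - u r m'))"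
      unfolding taylor by (simp add: sum_subtractf algebra_simps)
    then have "dist_int (poly p (real (m + j)) - poly p (real (m' + j)))
        \<le> (\<Sum>r\<le>d. dist_int (of_int (int j ^ r) * (u r m - u r m')))"
      using dist_int_sum by metis
    also have "\<dots> \<le> (\<Sum>r\<le>d. \<delta> / real (d + 1))"
    proof (rule sum_mono)
      fix r assume r: "r \<in> {..d}"
      have "dist_int (of_int (int j ^ r) * (u r m - u r m')) \<le> real j ^ r * dist_int (u r m - u r m')"
        using dist_int_of_int_mult[of "int j ^ r" "u r m - u r m'"] by simp
      also have "\<dots> \<le> real n ^ d * dist_int (u r m - u r m')"
      proof (intro mult_right_mono dist_int_nonneg)
        have "real j ^ r \<le> real n ^ r" using j by (intro power_mono) auto
        also have "\<dots> \<le> real n ^ d" using j r by (intro power_increasing) auto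
        finally show "real j ^ r \<le> real n ^ d" .
      qed
      also have "\<dots> \<le> \<delta> / real (d + 1)" using h r by blast
      finally show "dist_int (of_int (int j ^ r) * (u r m - u r m')) \<le> \<delta> / real (d + 1)" .
    qed
    also have "\<dots> = \<delta>" by simp
    finally show "dist_int (poly p (real (m + j)) - poly p (real (m' + j))) \<le> \<delta>" .
  qed
qed

text \<open>Blocks are aligned with the start of the window, so about \<open>n / L\<close> labels
  from \<open>A\<close> describe it. The additional label for an incomplete last block contributes
  the constant factor \<open>card A\<close>.\<close>

lemma codable_at_rate_blocks:
  fixes b :: "nat \<Rightarrow> 'b :: countable"
  assumes "0 < L" "\<And>s. b s \<in> A" "finite A" 
  shows "codable_at_rate (ln (card A) / L) (\<lambda>n m m'. \<forall>i. i * L < n \<longrightarrow> b (m + i * L) = b (m' + i * L))"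
proof -
  define B where "B = card A"
  have B: "1 \<le> B" using assms card_gt_0_iff[of A] unfolding B_def by force
  show ?thesis
  proof (rule codable_at_rateI[where c = "\<lambda>n m. map (\<lambda>i. b (m + i * L)) [0..<n div L + 1]"
        and A = "\<lambda>n. {xs. set xs \<subseteq> A \<and> length xs = n div L + 1}" and C = B])
    fix n
    show "finite {xs. set xs \<subseteq> A \<and> length xs = n div L + 1}"
      using assms by (rule_tac finite_lists_length_eq)
    have "real (card {xs. set xs \<subseteq> A \<and> length xs = n div L + 1}) = real B * real B powr (real (n div L))"
      using B assms by (simp add: card_lists_length_eq B_def powr_realpow)
    also have "\<dots> \<le> real B * real B powr (n / L)"
    proof (intro mult_left_mono powr_mono)
      have "real (n div L) * L \<le> n"
        by (metis div_times_less_eq_dividend of_nat_le_iff of_nat_mult)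
      then show "real (n div L) \<le> n / L" using assms(1) by (simp add: field_simps)
    qed (use B in auto)
    also have "\<dots> = real B * exp (ln (card A) / L * n)" using B by (simp add: powr_def B_def)
    finally show "real (card {xs. set xs \<subseteq> A \<and> length xs = n div L + 1}) \<le> real B * exp (ln (card A) / L * n)" .
  next
    fix n m m'
    assume "map (\<lambda>i. b (m + i * L)) [0..<n div L + 1] = map (\<lambda>i. b (m' + i * L)) [0..<n div L + 1]"
    then have "b (m + i * L) = b (m' + i * L)" if "i < n div L + 1" for i
      using that by (metis (no_types, lifting) map_eq_conv atLeastLessThan_iff atLeastLessThan_upt zero_le)
    moreover have "i < n div L + 1" if "i * L < n" for i
      using that assms(1) by (metis Suc_eq_plus1 less_Suc_eq_le less_eq_div_iff_mult_less_eq less_imp_le)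
    ultimately show "\<forall>i. i * L < n \<longrightarrow> b (m + i * L) = b (m' + i * L)" by blast
  qed (use assms in auto)
qed

subsection \<open>Iterated covers\<close>

lemma finite_iterated_cover: "finite \<U> \<Longrightarrow> finite (iterated_cover X T \<U> n)"
proof (induction n)
  case (Suc n)
  then show ?case
    unfolding iterated_cover.simps cover_join_def cover_preimage_def
    by (intro finite_image_set2) auto
qed simp

lemma Union_iterated_cover:
  assumes "\<Union>\<U> = topspace X" "T \<in> topspace X \<rightarrow> topspace X"
  shows "\<Union>(iterated_cover X T \<U> n) = topspace X"
proof (induction n)
  case (Suc n)
  have "(T ^^ n) x \<in> topspace X" if "x \<in> topspace X" for x
    using assms(2) that by (induction n) auto
  then have "\<Union>(cover_preimage X (T ^^ n) \<U>) = topspace X"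
    unfolding cover_preimage_def using assms(1) by blast
  moreover have "\<Union>(cover_join \<A> \<B>) = \<Union>\<A> \<inter> \<Union>\<B>" for \<A> \<B> :: "'a set set"
    unfolding cover_join_def by blast
  ultimately show ?case using Suc by simp
qed simp

lemma iterated_cover_itinerary:
  assumes "W \<in> iterated_cover X T \<U> n" "x \<in> W" "y \<in> W" "j < n"
  shows "\<exists>U\<in>\<U>. (T ^^ j) x \<in> U \<and> (T ^^ j) y \<in> U"
  using assms
proof (induction n arbitrary: W)
  case (Suc n)
  then obtain W' U where W: "W = W' \<inter> {x \<in> topspace X. (T ^^ n) x \<in> U}" "U \<in> \<U>"
    "W' \<in> iterated_cover X T \<U> n"
    by (auto simp: cover_join_def cover_preimage_def)
  then show ?case using Suc by (cases "j = n") auto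
qed simp

lemma iterated_coverI:
  assumes "\<And>j. j < n \<Longrightarrow> u j \<in> \<U>"
  shows "{x \<in> topspace X. \<forall>j<n. (T ^^ j) x \<in> u j} \<in> iterated_cover X T \<U> n"
  using assms
proof (induction n)
  case (Suc n)
  have "{x \<in> topspace X. \<forall>j<Suc n. (T ^^ j) x \<in> u j} =
    {x \<in> topspace X. \<forall>j<n. (T ^^ j) x \<in> u j} \<inter> {x \<in> topspace X. (T ^^ n) x \<in> u n}"
    by (auto simp: less_Suc_eq)
  moreover have "{x \<in> topspace X. \<forall>j<n. (T ^^ j) x \<in> u j} \<in> iterated_cover X T \<U> n"
    using Suc by simp
  moreover have "{x \<in> topspace X. (T ^^ n) x \<in> u n} \<in> cover_preimage X (T ^^ n) \<U>"
    unfolding cover_preimage_def using Suc.prems by simp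
  ultimately show ?case
    unfolding iterated_cover.simps cover_join_def by (intro CollectI exI conjI)
qed simp

lemma cover_number_le:
  assumes "\<V> \<subseteq> \<U>" "finite \<V>" "\<Union>\<V> = topspace X"
  shows "cover_number X \<U> \<le> card \<V>"
  unfolding cover_number_def using assms by (intro cInf_lower) auto

text \<open>Among the naturals the infimum of the empty set is 0, so attainment requires a
  candidate; the finite cover itself is one.\<close>

lemma cover_number_attained:
  assumes "finite \<U>" "\<Union>\<U> = topspace X"
  obtains \<V> where "\<V> \<subseteq> \<U>" "finite \<V>" "\<Union>\<V> = topspace X" "card \<V> = cover_number X \<U>"
proof -
  have "cover_number X \<U> \<in> {card \<V> | \<V>. \<V> \<subseteq> \<U> \<and> finite \<V> \<and> \<Union>\<V> = topspace X}"
    unfolding cover_number_def by (rule Inf_nat_def1) (use assms in blast)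
  then show thesis using that by auto
qed

lemma topological_entropy_nonneg: "0 \<le> topological_entropy X T"
proof -
  have "0 \<le> cover_entropy X T {topspace X}"
    unfolding cover_entropy_def
  proof (rule le_Limsup)
    \<comment> \<open>The convention \<open>ln 0 = 0\<close> settles a cover number 0, which occurs
      on the empty space.\<close>
    have "0 \<le> ln (real q)" for q :: nat by (cases q) auto
    then show "\<forall>\<^sub>F n in sequentially.
        0 \<le> ereal (ln (real (cover_number X (iterated_cover X T {topspace X} n))) / real n)"
      by simp
  qed simp
  also have "\<dots> \<le> topological_entropy X T"
    unfolding topological_entropy_def
    by (rule SUP_upper) (simp add: open_cover_def)
  finally show ?thesis .
qed

subsection \<open>Windows of deterministic functions\<close>

text \<open>Along the orbit \<open>F\<close> takes only the values 0 and 1, which an open cover can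
  tell apart. Distinct words therefore need distinct members of the iterated cover, and zero entropy
  bounds the number of these.\<close>

lemma codable_at_rate_deterministic:
  fixes S :: "nat set"
  assumes "deterministic TYPE('a) (indicator S)" "0 < \<eta>"
  shows "codable_at_rate \<eta> (\<lambda>n m m'. \<forall>j<n. m + j \<in> S \<longleftrightarrow> m' + j \<in> S)"
proof -
  obtain X :: "'a topology" and T x\<^sub>0 and F :: "'a \<Rightarrow> complex" where X: "continuous_map X X T" "topological_entropy X T = 0"
      "x\<^sub>0 \<in> topspace X" "continuous_map X euclidean F" "\<And>n. indicator S n = F ((T ^^ n) x\<^sub>0)"
    using assms(1) unfolding deterministic_def by blast
  have T: "T \<in> topspace X \<rightarrow> topspace X" using X(1) by (simp add: continuous_map_def)
  have orbit: "(T ^^ m) x\<^sub>0 \<in> topspace X" for m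
    by (induction m) (use X(3) T in auto)
  \<comment> \<open>An orbit point in the first set has value 0 and one in the second has value 1,
    so two orbit points in a common member have equal values.\<close>
  define \<U> where "\<U> = {{x \<in> topspace X. F x \<in> - {1}}, {x \<in> topspace X. F x \<in> - {0}}}"
  have open_\<U>: "open_cover X \<U>"
    unfolding open_cover_def
  proof
    show "\<forall>U\<in>\<U>. openin X U"
      unfolding \<U>_def
      using openin_continuous_map_preimage[OF X(4), of "- {1}"]
        openin_continuous_map_preimage[OF X(4), of "- {0}"] by (simp add: open_Compl)
    show "\<Union>\<U> = topspace X" unfolding \<U>_def by auto
  qed
  define word where "word n m = map (\<lambda>j. m + j \<in> S) [0..<n]" for n m
  define q where "q n = cover_number X (iterated_cover X T \<U> n)" for n
  have finite_words: "finite (range (word n))" for n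
    by (rule finite_subset[OF _ finite_lists_length_eq[of "UNIV :: bool set" n]])
      (auto simp: word_def)
  have card_words: "card (range (word n)) \<le> q n" for n
  proof -
    obtain \<V> where \<V>: "\<V> \<subseteq> iterated_cover X T \<U> n" "finite \<V>" "\<Union>\<V> = topspace X" "card \<V> = q n"
    proof (rule cover_number_attained)
      show "finite (iterated_cover X T \<U> n)" by (rule finite_iterated_cover) (simp add: \<U>_def)
      show "\<Union>(iterated_cover X T \<U> n) = topspace X"
        using open_\<U> T by (intro Union_iterated_cover) (auto simp: open_cover_def)
    qed (use q_def in auto)
    \<comment> \<open>A member without orbit points gets an arbitrary time; this is harmless, since
      only an upper bound for the number of words is wanted.\<close>
    define m where "m W = (SOME m. (T ^^ m) x\<^sub>0 \<in> W)" for W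
    have "range (word n) \<subseteq> (\<lambda>W. word n (m W)) ` \<V>"
    proof
      fix xs assume "xs \<in> range (word n)"
      then obtain i where i: "xs = word n i" by blast
      obtain W where W: "W \<in> \<V>" "(T ^^ i) x\<^sub>0 \<in> W" using orbit \<V>(3) by blast
      have mW: "(T ^^ m W) x\<^sub>0 \<in> W" unfolding m_def by (rule someI[of _ i]) (rule W)
      have "i + j \<in> S \<longleftrightarrow> m W + j \<in> S" if j: "j < n" for j
      proof -
        obtain U where "U \<in> \<U>" "(T ^^ j) ((T ^^ i) x\<^sub>0) \<in> U" "(T ^^ j) ((T ^^ m W) x\<^sub>0) \<in> U"
          using iterated_cover_itinerary[OF _ W(2) mW j] \<V>(1) W(1) by blast
        moreover have "F ((T ^^ j) ((T ^^ l) x\<^sub>0)) = indicator S (l + j)" for l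
          using X(5)[of "l + j"] by (simp add: funpow_add add.commute)
        ultimately show ?thesis
          unfolding \<U>_def by (auto simp: indicator_def split: if_splits)
      qed
      then have "xs = word n (m W)" unfolding i word_def by simp
      then show "xs \<in> (\<lambda>W. word n (m W)) ` \<V>" using W(1) by blast
    qed
    then show ?thesis using surj_card_le[OF \<V>(2)] \<V>(4) by metis
  qed
  have "cover_entropy X T \<U> \<le> topological_entropy X T"
    unfolding topological_entropy_def using open_\<U> by (intro SUP_upper) auto
  then have "limsup (\<lambda>n. ereal (ln (real (q n)) / real n)) < ereal \<eta>"
    using X(2) assms(2) unfolding cover_entropy_def q_def by (simp add: order.strict_trans1)
  then have "\<forall>\<^sub>F n in sequentially. ereal (ln (real (q n)) / real n) < ereal \<eta>"
    by (rule Limsup_lessD)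
  then obtain n0 where n0: "\<And>n. n0 \<le> n \<Longrightarrow> ln (real (q n)) / real n < \<eta>"
    unfolding eventually_sequentially by auto
  \<comment> \<open>The sum takes care of the \<open>n \<le> n0\<close>, about which the upper limit
    says nothing.\<close>
  define C where "C = 1 + (\<Sum>n\<le>n0. real (q n))"
  have C: "1 \<le> C" unfolding C_def by (simp add: sum_nonneg)
  show ?thesis
  proof (rule codable_at_rateI[where c = word and A = "\<lambda>n. range (word n)" and C = C])
    fix n
    have "real (q n) \<le> C * exp (\<eta> * real n)"
    proof (cases "n \<le> n0")
      case True
      then have "real (q n) \<le> (\<Sum>n\<le>n0. real (q n))"
        by (intro member_le_sum) auto
      then have "real (q n) \<le> C * 1" unfolding C_def by simp
      also have "\<dots> \<le> C * exp (\<eta> * real n)" using C assms(2) by (intro mult_left_mono) auto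
      finally show ?thesis .
    next
      case False
      then have "ln (real (q n)) < \<eta> * real n" using n0[of n] by (simp add: field_simps)
      then have "exp (ln (real (q n))) \<le> exp (\<eta> * real n)" by simp
      then have "real (q n) \<le> 1 * exp (\<eta> * real n)"
        by (cases "q n = 0") simp_all
      also have "\<dots> \<le> C * exp (\<eta> * real n)" using C by (intro mult_right_mono) auto
      finally show ?thesis .
    qed
    then show "real (card (range (word n))) \<le> C * exp (\<eta> * real n)"
      using card_words[of n] by linarith
  next
    show "\<forall>j<n. m + j \<in> S \<longleftrightarrow> m' + j \<in> S" if "word n m = word n m'" for n m m'
      using that unfolding word_def by (auto simp: map_eq_conv)
  qed (use finite_words in auto)
qed

section \<open>Realising a codable function on its orbit closure\<close>

lemma dist_fun_less_if_coordinates_close: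
  assumes "0 < \<delta>"
  obtains \<epsilon> J where "0 < \<epsilon>"
    "\<And>x y :: nat \<Rightarrow> 'b :: metric_space. (\<And>i. i < J \<Longrightarrow> dist (x i) (y i) \<le> \<epsilon>) \<Longrightarrow> dist x y < \<delta>"
proof -
  obtain N where N: "(1 / 2) ^ N < \<delta> / 2"
    using real_arch_pow_inv[of "\<delta> / 2" "1 / 2"] assms by auto
  define J where "J = Suc (Max (from_nat ` {..N} :: nat set))"
  have J: "from_nat n < J" if "n \<le> N" for n
    unfolding J_def less_Suc_eq_le using that by (intro Max_ge) auto
  show thesis
  \<comment> \<open>The controlled coordinates contribute at most twice \<open>\<delta> / 8\<close>
    to the distance, and the tail less than \<open>\<delta> / 2\<close>.\<close>
  proof (rule that[of "\<delta> / 8" J])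
    fix x y :: "nat \<Rightarrow> 'b"
    assume "\<And>i. i < J \<Longrightarrow> dist (x i) (y i) \<le> \<delta> / 8"
    then have "Max {dist (x (from_nat n)) (y (from_nat n)) | n. n \<le> N} \<le> \<delta> / 8"
      using J by (subst Max_le_iff) auto
    then show "dist x y < \<delta>"
      using dist_fun_le_dist_first_terms[of x y N] N assms by linarith
  qed (use assms in simp)
qed

text \<open>The converse direction realises \<open>\<xi>\<close> on the closure of its orbit under the shift.\<close>
lemma deterministic_if_codable:
  fixes \<xi> :: "nat \<Rightarrow> complex"
  assumes "bounded (range \<xi>)"
    and cod: "\<And>\<epsilon> \<eta>. 0 < \<epsilon> \<Longrightarrow> 0 < \<eta> \<Longrightarrow>
      codable_at_rate \<eta> (\<lambda>n m m'. \<forall>j<n. dist (\<xi> (m + j)) (\<xi> (m' + j)) \<le> \<epsilon>)"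
  shows "deterministic TYPE(nat \<Rightarrow> complex) \<xi>"
proof -
  define orb where "orb m = (\<lambda>j. \<xi> (m + j))" for m
  define K where "K = closure (range orb)"
  define T where "T = (\<lambda>(x :: nat \<Rightarrow> complex) j. x (Suc j))"
  define X where "X = top_of_set K"
  have [simp]: "topspace X = K" by (simp add: X_def)
  have contT: "continuous_on A T" for A
    unfolding T_def
    by (intro continuous_on_coordinatewise_then_product continuous_on_subset[OF continuous_on_product_coordinates]) simp
  have T_orb: "T (orb m) = orb (Suc m)" for m by (simp add: T_def orb_def)
  have TK: "T ` K \<subseteq> K"
    unfolding K_def
  proof (rule image_closure_subset)
    show "T ` range orb \<subseteq> closure (range orb)"
      by (auto simp: T_orb intro!: subsetD[OF closure_subset])
  qed (use contT in auto)
  have T_pow: "(T ^^ j) x i = x (i + j)" for j x i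
    by (induction j arbitrary: i) (simp_all add: T_def)
  have T_pow_K: "(T ^^ j) x \<in> K" if "x \<in> K" for j x
    by (induction j) (use that TK in auto)
  have orb_K: "orb m \<in> K" for m
    unfolding K_def by (auto intro!: subsetD[OF closure_subset])
  obtain B where B: "\<And>n. norm (\<xi> n) \<le> B" using assms(1) unfolding bounded_iff by auto
  have "compact K"
  proof -
    have "compact (PiE UNIV (\<lambda>_. cball 0 B) :: (nat \<Rightarrow> complex) set)"
      using compactin_PiE[of "\<lambda>_. euclidean" UNIV "\<lambda>_. cball (0 :: complex) B"]
      by (simp add: euclidean_product_topology)
    moreover have "K \<subseteq> PiE UNIV (\<lambda>_. cball 0 B)"
      unfolding K_def
      by (rule closure_minimal) (use B calculation compact_imp_closed in \<open>auto simp: orb_def\<close>)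
    ultimately show ?thesis
      by (metis K_def closed_closure compact_Int_closed inf.absorb_iff2)
  qed
  have cover_entropy_le: "cover_entropy X T \<U> \<le> ereal \<eta>" if \<U>: "open_cover X \<U>" and "0 < \<eta>" for \<U> \<eta>
  proof -
    \<comment> \<open>Extending the members to open sets of the whole sequence space gives access to
      a Lebesgue number \<open>\<delta>\<close> of the cover; closeness in the first
      \<open>J\<close> coordinates then keeps points of \<open>K\<close> in one member.\<close>
    define \<G> where "\<G> = {G. open G \<and> K \<inter> G \<in> \<U>}"
    have "K \<subseteq> \<Union>\<G>"
    proof
      fix x assume "x \<in> K"
      then obtain U where "U \<in> \<U>" "x \<in> U" using \<U> unfolding open_cover_def by auto
      moreover obtain G where "open G" "U = K \<inter> G"
        using \<U> \<open>U \<in> \<U>\<close> unfolding open_cover_def X_def openin_open by auto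
      ultimately show "x \<in> \<Union>\<G>" unfolding \<G>_def by blast
    qed
    then obtain \<delta> where \<delta>: "0 < \<delta>" "\<And>x. x \<in> K \<Longrightarrow> \<exists>G\<in>\<G>. ball x \<delta> \<subseteq> G"
      by (rule Heine_Borel_lemma[OF \<open>compact K\<close>]) (auto simp: \<G>_def)
    obtain \<epsilon> J where \<epsilon>: "0 < \<epsilon>"
      "\<And>x y :: nat \<Rightarrow> complex. (\<And>i. i < J \<Longrightarrow> dist (x i) (y i) \<le> \<epsilon>) \<Longrightarrow> dist x y < \<delta>"
      using dist_fun_less_if_coordinates_close[OF \<delta>(1)] by blast
    have "\<exists>U\<in>\<U>. \<forall>y\<in>K. (\<forall>i<J. dist (x i) (y i) \<le> \<epsilon>) \<longrightarrow> y \<in> U" if x: "x \<in> K" for x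
    proof -
      obtain G where G: "G \<in> \<G>" "ball x \<delta> \<subseteq> G" using \<delta>(2)[OF x] by blast
      have "y \<in> K \<inter> G" if "y \<in> K" "\<forall>i<J. dist (x i) (y i) \<le> \<epsilon>" for y
        using \<epsilon>(2)[of x y] that G(2) by auto
      then show ?thesis using G(1) unfolding \<G>_def by blast
    qed
    then have "\<forall>m. \<exists>U\<in>\<U>. \<forall>y\<in>K. (\<forall>i<J. dist (orb m i) (y i) \<le> \<epsilon>) \<longrightarrow> y \<in> U"
      using orb_K by blast
    then obtain u where u: "\<And>m. u m \<in> \<U>"
      "\<And>m y. y \<in> K \<Longrightarrow> (\<And>i. i < J \<Longrightarrow> dist (orb m i) (y i) \<le> \<epsilon>) \<Longrightarrow> y \<in> u m"
      by metis
    \<comment> \<open>Half of the rate is kept back to absorb the constant \<open>D\<close> for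
      large \<open>n\<close>.\<close>
    have "codable_at_rate (\<eta> / 2) (\<lambda>n m m'. \<forall>j<n. dist (\<xi> (m + j)) (\<xi> (m' + j)) \<le> \<epsilon>)"
      using cod \<epsilon>(1) \<open>0 < \<eta>\<close> by simp
    then obtain C c where c: "\<And>n. finite (range (c n :: nat \<Rightarrow> nat))"
      "\<And>n. real (card (range (c n))) \<le> C * exp (\<eta> / 2 * real n)"
      "\<And>n m m' j. c n m = c n m' \<Longrightarrow> j < n \<Longrightarrow> dist (\<xi> (m + j)) (\<xi> (m' + j)) \<le> \<epsilon>"
      unfolding codable_at_rate_def by metis
    define q where "q n = cover_number X (iterated_cover X T \<U> n)" for n
    \<comment> \<open>Locating \<open>(T ^^ j) x\<close> in the cover takes the coordinates
      \<open>j\<close> to \<open>j + J - 1\<close> of \<open>x\<close>, hence the windows of length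
      \<open>n + J\<close>.\<close>
    have q_le: "q n \<le> card (range (c (n + J)))" for n
    proof -
      define m where "m a = (SOME m. c (n + J) m = a)" for a
      define V where "V a = {x \<in> K. \<forall>j<n. (T ^^ j) x \<in> u (m a + j)}" for a
      \<comment> \<open>The inequality is not strict, so \<open>Z a\<close> is closed. Finitely many
        such sets cover the orbit and hence also its closure \<open>K\<close>.\<close>
      define Z where "Z a = {x. \<forall>i\<in>{..<n + J}. dist (orb (m a) i) (x i) \<le> \<epsilon>}" for a
      have ZV: "x \<in> V a" if "x \<in> K" "x \<in> Z a" for x a
        unfolding V_def
      proof (intro CollectI conjI allI impI u(2) T_pow_K that)
        show "dist (orb (m a + j) i) ((T ^^ j) x i) \<le> \<epsilon>" if "j < n" "i < J" for j i
          using \<open>x \<in> Z a\<close> that unfolding Z_def T_pow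
          by (auto simp: orb_def add_ac dest!: bspec[of _ _ "i + j"])
      qed
      have "closed (Z a)" for a
      proof -
        have "Z a = (\<Inter>i\<in>{..<n + J}. {x. dist (orb (m a) i) (x i) \<le> \<epsilon>})"
          unfolding Z_def by auto
        moreover have "closed \<dots>"
          by (intro closed_INT ballI closed_Collect_le continuous_on_dist continuous_on_const
              continuous_on_product_coordinates)
        ultimately show ?thesis by simp
      qed
      then have "closed (\<Union>a\<in>range (c (n + J)). Z a)"
        using c(1) by (intro closed_UN) auto
      moreover have "range orb \<subseteq> (\<Union>a\<in>range (c (n + J)). Z a)"
      proof
        fix x assume "x \<in> range orb"
        then obtain l where l: "x = orb l" by blast
        have "c (n + J) (m (c (n + J) l)) = c (n + J) l"
          unfolding m_def by (rule someI[of _ l]) simp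
        then have "x \<in> Z (c (n + J) l)" unfolding Z_def l orb_def using c(3) by auto
        then show "x \<in> (\<Union>a\<in>range (c (n + J)). Z a)" by blast
      qed
      ultimately have "K \<subseteq> (\<Union>a\<in>range (c (n + J)). Z a)"
        unfolding K_def by (rule closure_minimal[rotated])
      then have "\<Union>(V ` range (c (n + J))) = topspace X"
        using ZV unfolding V_def by fastforce
      moreover have "V ` range (c (n + J)) \<subseteq> iterated_cover X T \<U> n"
        unfolding V_def using iterated_coverI[of n _ \<U> X T] u(1) by auto
      ultimately have "q n \<le> card (V ` range (c (n + J)))"
        unfolding q_def using c(1) by (intro cover_number_le) auto
      also have "\<dots> \<le> card (range (c (n + J)))" using c(1) by (rule card_image_le)
      finally show ?thesis .
    qed
    define D where "D = max 1 (C * exp (\<eta> / 2 * real J))"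
    have q_exp: "real (q n) \<le> D * exp (\<eta> / 2 * real n)" for n
    proof -
      have "real (q n) \<le> C * exp (\<eta> / 2 * real (n + J))"
        using q_le[of n] c(2)[of "n + J"] by linarith
      also have "\<dots> = (C * exp (\<eta> / 2 * real J)) * exp (\<eta> / 2 * real n)"
        by (simp add: exp_add distrib_left algebra_simps add_divide_distrib)
      also have "\<dots> \<le> D * exp (\<eta> / 2 * real n)"
        unfolding D_def by (intro mult_right_mono) auto
      finally show ?thesis .
    qed
    have D: "1 \<le> D" by (simp add: D_def)
    have "\<forall>\<^sub>F n in sequentially. 2 * ln D / \<eta> < real n"
      by (rule eventually_gt_at_top[THEN filterlim_real_sequentially[unfolded filterlim_iff, rule_format]])
    then have "\<forall>\<^sub>F n in sequentially. ereal (ln (real (q n)) / real n) \<le> ereal \<eta>"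
    proof (rule eventually_mono)
      fix n assume n: "2 * ln D / \<eta> < real n"
      have "0 < real n" using n D \<open>0 < \<eta>\<close> by (smt (verit) divide_nonneg_pos ln_ge_zero)
      have "ln (real (q n)) \<le> ln D + \<eta> / 2 * real n"
      proof (cases "q n = 0")
        case True
        then show ?thesis using D \<open>0 < \<eta>\<close> by simp
      next
        case False
        then have "ln (real (q n)) \<le> ln (D * exp (\<eta> / 2 * real n))"
          using q_exp[of n] by (intro ln_mono) auto
        also have "\<dots> = ln D + \<eta> / 2 * real n" using D by (subst ln_mult) auto
        finally show ?thesis .
      qed
      also have "\<dots> \<le> \<eta> * real n" using n \<open>0 < \<eta>\<close> by (simp add: field_simps)
      finally show "ereal (ln (real (q n)) / real n) \<le> ereal \<eta>"
        using \<open>0 < real n\<close> by (simp add: field_simps)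
    qed
    then show ?thesis unfolding cover_entropy_def q_def by (rule Limsup_bounded)
  qed
  have "topological_entropy X T \<le> 0"
    unfolding topological_entropy_def
  proof (rule SUP_least)
    fix \<U> assume \<U>: "\<U> \<in> {\<U>. open_cover X \<U>}"
    show "cover_entropy X T \<U> \<le> 0"
    proof (rule ereal_le_epsilon2)
      show "cover_entropy X T \<U> \<le> 0 + ereal \<eta>" if "0 < \<eta>" for \<eta>
        using cover_entropy_le[OF _ that] \<U> by simp
    qed
  qed
  then have "topological_entropy X T = 0" by (intro antisym topological_entropy_nonneg)
  moreover have "compact_space X"
    unfolding X_def using \<open>compact K\<close> by (intro compact_space_subtopology) simp
  moreover have "Hausdorff_space X"
    unfolding X_def by (intro Hausdorff_space_subtopology) simp
  moreover have "continuous_map X X T"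
    unfolding X_def using contT TK by (simp add: continuous_map_iff_continuous continuous_map_in_subtopology image_subset_iff_funcset)
  moreover have "continuous_map X euclidean (\<lambda>x. x 0)"
    unfolding X_def using continuous_on_subset[OF continuous_on_product_coordinates] by simp
  moreover have "\<xi> n = (T ^^ n) (orb 0) 0" for n by (simp add: T_pow orb_def)
  ultimately show ?thesis
    unfolding deterministic_def
    by (intro exI[of _ X] exI[of _ T] exI[of _ "orb 0"] exI[of _ "\<lambda>x. x 0"]) (simp add: orb_K)
qed

subsection \<open>Windows of concatenations\<close>

text \<open>The words of the \<open>S v\<close> tell which polynomial is active at each position.
  All polynomials are coded along the whole window, active or not, so the two codes combine without
  regard to the pattern.\<close>

lemma codable_at_rate_partition_poly:
  fixes p :: "'i \<Rightarrow> real poly" and S :: "'i \<Rightarrow> nat set"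
  assumes "finite I" "(\<Union>v\<in>I. S v) = UNIV" "disjoint_family_on S I"
    and S: "\<And>v \<eta>. v \<in> I \<Longrightarrow> 0 < \<eta> \<Longrightarrow>
      codable_at_rate \<eta> (\<lambda>n m m'. \<forall>j<n. m + j \<in> S v \<longleftrightarrow> m' + j \<in> S v)"
    and g: "\<And>n. g n = (\<Sum>v\<in>I. indicator (S v) n * poly (p v) (real n))"
    and "0 < \<delta>" "0 < \<eta>"
  shows "codable_at_rate \<eta> (\<lambda>n m m'. \<forall>j<n. dist_int (g (m + j) - g (m' + j)) \<le> \<delta>)"
proof -
  have g_eq: "g n = poly (p v) (real n)" if "n \<in> S v" "v \<in> I" for n v
  proof -
    have "indicator (S v') n * poly (p v') (real n) = (if v' = v then poly (p v) (real n) else 0)"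
      if "v' \<in> I" for v'
      using that \<open>n \<in> S v\<close> \<open>v \<in> I\<close> assms(3) by (auto simp: disjoint_family_on_def indicator_def)
    then show ?thesis unfolding g using that assms(1) by simp
  qed
  have "codable_at_rate (\<eta> / 2) (\<lambda>n m m'. \<forall>v\<in>I. \<forall>j<n. m + j \<in> S v \<longleftrightarrow> m' + j \<in> S v)"
    using \<open>0 < \<eta>\<close> by (intro codable_at_rate_ball[OF assms(1) S]) simp_all
  moreover have "codable_at_rate (\<eta> / 2) (\<lambda>n m m'. \<forall>v\<in>I. \<forall>j<n.
      dist_int (poly (p v) (real (m + j)) - poly (p v) (real (m' + j))) \<le> \<delta>)"
    using \<open>0 < \<eta>\<close> \<open>0 < \<delta>\<close>
    by (intro codable_at_rate_ball[OF assms(1) codable_at_rate_poly]) simp_all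
  ultimately have "codable_at_rate (\<eta> / 2 + \<eta> / 2) (\<lambda>n m m'.
      (\<forall>v\<in>I. \<forall>j<n. m + j \<in> S v \<longleftrightarrow> m' + j \<in> S v) \<and>
      (\<forall>v\<in>I. \<forall>j<n. dist_int (poly (p v) (real (m + j)) - poly (p v) (real (m' + j))) \<le> \<delta>))"
    by (rule codable_at_rate_conj)
  then have "codable_at_rate \<eta> (\<lambda>n m m'.
      (\<forall>v\<in>I. \<forall>j<n. m + j \<in> S v \<longleftrightarrow> m' + j \<in> S v) \<and>
      (\<forall>v\<in>I. \<forall>j<n. dist_int (poly (p v) (real (m + j)) - poly (p v) (real (m' + j))) \<le> \<delta>))"
    by simp
  then show ?thesis
  proof (rule codable_at_rate_mono, intro allI impI, elim conjE)
    fix n m m' j :: nat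
    assume h: "\<forall>v\<in>I. \<forall>j<n. m + j \<in> S v \<longleftrightarrow> m' + j \<in> S v"
      "\<forall>v\<in>I. \<forall>j<n. dist_int (poly (p v) (real (m + j)) - poly (p v) (real (m' + j))) \<le> \<delta>" "j < n"
    obtain v where v: "v \<in> I" "m + j \<in> S v" using assms(2) by blast
    then have "m' + j \<in> S v" using h by blast
    then show "dist_int (g (m + j) - g (m' + j)) \<le> \<delta>"
      using h(2,3) v g_eq by metis
  qed
qed

text \<open>From \<open>N I\<close> on, consecutive breakpoints are at least \<open>L\<close> apart,
  so a block of length \<open>L\<close> is cut at most once; \<open>c\<close> is the offset of the
  cut.\<close>

lemma concatenation_single_breakpoint:
  assumes "admissible_seq N" "is_concatenation fs N f"
  obtains M where "\<And>s. M \<le> s \<Longrightarrow> \<exists>c\<le>L. (\<exists>i. \<forall>n. s \<le> n \<longrightarrow> n < s + c \<longrightarrow> f n = fs i n) \<and>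
    (\<exists>i. \<forall>n. s + c \<le> n \<longrightarrow> n < s + L \<longrightarrow> f n = fs i n)"
proof -
  have N: "N 0 = 0" "strict_mono N" using assms(1) by (auto simp: admissible_seq_def)
  have f: "f n = fs i n" if "N i \<le> n" "n < N (Suc i)" for i n
    using assms(2) that by (simp add: is_concatenation_def)
  have "\<forall>\<^sub>F i in sequentially. L \<le> N (Suc i) - N i"
    using assms(1) by (simp add: admissible_seq_def filterlim_at_top)
  then obtain I where I: "\<And>i. I \<le> i \<Longrightarrow> L \<le> N (Suc i) - N i"
    unfolding eventually_sequentially by blast
  show thesis
  proof (rule that[of "N I"])
    fix s assume s: "N I \<le> s"
    define i where "i = (LEAST i. s < N (Suc i))"
    have "s < N (Suc s)" using strict_mono_imp_increasing[OF N(2), of "Suc s"] by linarith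
    then have i1: "s < N (Suc i)" unfolding i_def by (rule LeastI)
    have i0: "N i \<le> s"
    proof (cases i)
      case 0
      then show ?thesis using N by simp
    next
      case (Suc i')
      then have "\<not> s < N (Suc i')" unfolding i_def by (metis lessI not_less_Least)
      then show ?thesis using Suc by simp
    qed
    have "I \<le> i"
    proof (rule ccontr)
      assume "\<not> I \<le> i"
      then have "N (Suc i) \<le> N I" using N(2) by (simp add: strict_mono_less_eq)
      with i1 s show False by linarith
    qed
    then have gap: "N (Suc i) + L \<le> N (Suc (Suc i))"
      using I[of "Suc i"] strict_monoD[OF N(2), of "Suc i" "Suc (Suc i)"] by simp
    \<comment> \<open>If the next breakpoint lies beyond the block, the minimum leaves the second
      piece empty.\<close>
    define c where "c = min L (N (Suc i) - s)"
    have "\<forall>n. s \<le> n \<longrightarrow> n < s + c \<longrightarrow> f n = fs i n"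
      using i0 unfolding c_def by (auto intro!: f)
    moreover have "\<forall>n. s + c \<le> n \<longrightarrow> n < s + L \<longrightarrow> f n = fs (Suc i) n"
      using i0 i1 gap unfolding c_def by (auto intro!: f)
    moreover have "c \<le> L" unfolding c_def by simp
    ultimately show "\<exists>c\<le>L. (\<exists>i. \<forall>n. s \<le> n \<longrightarrow> n < s + c \<longrightarrow> f n = fs i n) \<and>
      (\<exists>i. \<forall>n. s + c \<le> n \<longrightarrow> n < s + L \<longrightarrow> f n = fs i n)"
      by blast
  qed
qed

text \<open>Discrete integration is applied to the difference \<open>D\<close> of two shifted copies
  of \<open>f\<close>. Its initial differences are small by the codes; they belong to
  \<open>f\<close> itself and may look past the piece, so short pieces need no separate treatment.
  At order \<open>k\<close> the two approximation errors and the change of \<open>g\<close> cost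
  \<open>\<theta> / 3\<close> each.\<close>

lemma dist_int_window_le:
  assumes "0 < Q" "1 / real Q \<le> \<theta>"
    and codes: "\<And>i. i < k \<Longrightarrow> round_code Q ((fwd_diff ^^ i) f a) = round_code Q ((fwd_diff ^^ i) f a')"
    and f: "\<And>x. x \<le> u \<Longrightarrow> f (a + x) = h (a + x)" "\<And>x. x \<le> u \<Longrightarrow> f (a' + x) = h' (a' + x)"
    and h: "\<And>x. x \<le> u \<Longrightarrow> dist_int ((fwd_diff ^^ k) h (a + x) - g (a + x)) \<le> \<theta> / 3"
      "\<And>x. x \<le> u \<Longrightarrow> dist_int ((fwd_diff ^^ k) h' (a' + x) - g (a' + x)) \<le> \<theta> / 3"
    and g: "\<And>x. x \<le> u \<Longrightarrow> dist_int (g (a + x) - g (a' + x)) \<le> \<theta> / 3"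
  shows "dist_int (f (a + u) - f (a' + u)) \<le> \<theta> * (real u + 1) ^ k"
proof -
  define D where "D x = f (a + x) - f (a' + x)" for x
  have D: "(fwd_diff ^^ i) D x = (fwd_diff ^^ i) f (a + x) - (fwd_diff ^^ i) f (a' + x)" for i x
    unfolding D_def fwd_diff_funpow_diff by (simp add: fwd_diff_funpow_shift)
  have "0 \<le> \<theta>" using assms(1,2) by (meson divide_nonneg_nonneg of_nat_0_le_iff order_trans zero_le_one)
  have "dist_int (D (0 + u)) \<le> \<theta> * (real u + 1) ^ k"
  proof (rule dist_int_le_of_fwd_diff[where b = "Suc u"])
    show "dist_int ((fwd_diff ^^ i) D 0) \<le> \<theta>" if "i < k" for i
      using dist_int_le_of_round_code[OF assms(1) codes[OF that]] assms(2) unfolding D by simp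
  next
    \<comment> \<open>The bound keeps the offsets \<open>x\<close> to \<open>x + k\<close> inside
      the piece, where \<open>f\<close> agrees with \<open>h\<close> and \<open>h'\<close>.\<close>
    fix x assume "x + k < Suc u"
    then have xk: "y \<le> u" if "y \<le> x + k" for y
      using that by simp
    then have x: "x \<le> u" by simp
    have "(fwd_diff ^^ k) f (a + x) = (fwd_diff ^^ k) h (a + x)"
    proof (rule fwd_diff_funpow_cong)
      show "f j = h j" if "a + x \<le> j" "j \<le> a + x + k" for j
        using f(1)[OF xk[of "j - a"]] that by simp
    qed
    moreover have "(fwd_diff ^^ k) f (a' + x) = (fwd_diff ^^ k) h' (a' + x)"
    proof (rule fwd_diff_funpow_cong)
      show "f j = h' j" if "a' + x \<le> j" "j \<le> a' + x + k" for j
        using f(2)[OF xk[of "j - a'"]] that by simp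
    qed
    ultimately have "(fwd_diff ^^ k) D x = ((fwd_diff ^^ k) h (a + x) - g (a + x)) -
        ((fwd_diff ^^ k) h' (a' + x) - g (a' + x)) + (g (a + x) - g (a' + x))"
      unfolding D by simp
    then have "dist_int ((fwd_diff ^^ k) D x) \<le> dist_int ((fwd_diff ^^ k) h (a + x) - g (a + x)) +
        dist_int ((fwd_diff ^^ k) h' (a' + x) - g (a' + x)) + dist_int (g (a + x) - g (a' + x))"
      using dist_int_add dist_int_diff by (smt (verit))
    then show "dist_int ((fwd_diff ^^ k) D x) \<le> \<theta>" using h[OF x] g[OF x] by linarith
  qed (use \<open>0 \<le> \<theta>\<close> in auto)
  then show ?thesis by (simp add: D_def)
qed

text \<open>A block of length \<open>L\<close> is coded by the position of its only breakpoint together with the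
  rounded differences of order below \<open>k\<close> at the start of both pieces.\<close>
lemma codable_at_rate_concatenation:
  assumes "0 < L" "0 < Q" "1 / real Q \<le> \<theta>"
    and brk: "\<And>s. M \<le> s \<Longrightarrow> \<exists>c\<le>L. (\<exists>i. \<forall>n. s \<le> n \<longrightarrow> n < s + c \<longrightarrow> f n = fs i n) \<and>
      (\<exists>i. \<forall>n. s + c \<le> n \<longrightarrow> n < s + L \<longrightarrow> f n = fs i n)"
    and err: "\<And>i n. M \<le> n \<Longrightarrow> dist_int ((fwd_diff ^^ k) (fs i) n - g n) \<le> \<theta> / 3"
    and g: "codable_at_rate \<eta> (\<lambda>n m m'. \<forall>j<n. dist_int (g (m + j) - g (m' + j)) \<le> \<theta> / 3)"
  shows "codable_at_rate (\<eta> + ln (real ((L + 1) * (Q ^ k * Q ^ k))) / real L)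
    (\<lambda>n m m'. \<forall>j<n. dist_int (f (m + j) - f (m' + j)) \<le> \<theta> * real L ^ k)"
proof -
  have \<theta>: "0 \<le> \<theta>" using assms(2,3) by (meson divide_nonneg_nonneg of_nat_0_le_iff order_trans zero_le_one)
  define good where "good s c \<longleftrightarrow> (\<exists>i. \<forall>n. s \<le> n \<longrightarrow> n < s + c \<longrightarrow> f n = fs i n) \<and>
      (\<exists>i. \<forall>n. s + c \<le> n \<longrightarrow> n < s + L \<longrightarrow> f n = fs i n)" for s c
  have "\<forall>s. \<exists>c\<le>L. M \<le> s \<longrightarrow> good s c" using brk unfolding good_def by (metis le0)
  then obtain c where c: "\<And>s. c s \<le> L" "\<And>s. M \<le> s \<Longrightarrow> good s (c s)" by metis
  define jet where "jet a = map (\<lambda>i. round_code Q ((fwd_diff ^^ i) f a)) [0..<k]" for a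
  define J where "J = {xs. set xs \<subseteq> {..<Q} \<and> length xs = k}"
  have jet_J: "jet a \<in> J" for a
    unfolding jet_def J_def using round_code_less[OF assms(2)] by auto
  have jet_eq: "round_code Q ((fwd_diff ^^ i) f a) = round_code Q ((fwd_diff ^^ i) f a')"
    if "jet a = jet a'" "i < k" for a a' i
    using that unfolding jet_def by (simp add: map_eq_conv)
  define b where "b s = (c s, jet s, jet (s + c s))" for s
  have J: "finite J" "card J = Q ^ k"
    unfolding J_def using finite_lists_length_eq[of "{..<Q}"] card_lists_length_eq[of "{..<Q}"] by simp_all
  have "codable_at_rate (ln (real (card ({..L} \<times> (J \<times> J)))) / real L)
      (\<lambda>n m m'. \<forall>i. i * L < n \<longrightarrow> b (m + i * L) = b (m' + i * L))"
    by (rule codable_at_rate_blocks) (use assms(1) c jet_J J in \<open>auto simp: b_def\<close>)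
  then have "codable_at_rate (ln (real ((L + 1) * (Q ^ k * Q ^ k))) / real L)
      (\<lambda>n m m'. \<forall>i. i * L < n \<longrightarrow> b (m + i * L) = b (m' + i * L))"
    by (simp add: card_cartesian_product J)
  from codable_at_rate_conj[OF g this] show ?thesis
  proof (rule codable_at_rate_eventually[where M = M, OF codable_at_rate_mono], intro allI impI, elim conjE)
    fix n m m' j
    assume g: "\<forall>j<n. dist_int (g (m + j) - g (m' + j)) \<le> \<theta> / 3"
      and b: "\<forall>i. i * L < n \<longrightarrow> b (m + i * L) = b (m' + i * L)"
      and M: "M \<le> m" "M \<le> m'" and j: "j < n"
    \<comment> \<open>These are the blocks containing the compared positions. Equal codes give them
      the same cut, so both positions lie in corresponding pieces.\<close>
    define s s' t where "s = m + (j div L) * L" and "s' = m' + (j div L) * L" and "t = j mod L"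
    have t: "t < L" and mj: "m + j = s + t" "m' + j = s' + t"
      unfolding s_def s'_def t_def using assms(1) by simp_all
    have "(j div L) * L < n" using j by (metis div_times_less_eq_dividend le_less_trans)
    then have bs: "b s = b s'" using b unfolding s_def s'_def by blast
    then have cs: "c s' = c s" and jets: "jet s = jet s'" "jet (s + c s) = jet (s' + c s)"
      by (auto simp: b_def)
    have Ms: "M \<le> s" "M \<le> s'" using M unfolding s_def s'_def by auto
    \<comment> \<open>Both pieces are treated at once, \<open>a\<close> being the offset at which
      the piece starts. The indices \<open>i\<close> and \<open>i'\<close> may differ because the
      error bound is uniform in the index.\<close>
    have piece: "dist_int (f (m + j) - f (m' + j)) \<le> \<theta> * real L ^ k"
      if a: "a \<le> t" "jet (s + a) = jet (s' + a)"
        and fi: "\<And>x. a \<le> x \<Longrightarrow> x \<le> t \<Longrightarrow> f (s + x) = fs i (s + x)"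
        and fi': "\<And>x. a \<le> x \<Longrightarrow> x \<le> t \<Longrightarrow> f (s' + x) = fs i' (s' + x)" for a i i'
    proof -
      have "dist_int (f ((s + a) + (t - a)) - f ((s' + a) + (t - a))) \<le> \<theta> * (real (t - a) + 1) ^ k"
      proof (rule dist_int_window_le[where h = "fs i" and h' = "fs i'" and g = g, OF assms(2,3)])
        fix x assume x: "x \<le> t - a"
        show "f (s + a + x) = fs i (s + a + x)" "f (s' + a + x) = fs i' (s' + a + x)"
          using fi[of "a + x"] fi'[of "a + x"] x a(1) by (simp_all add: add.assoc)
        \<comment> \<open>Integration consults \<open>g\<close> only at offsets up to
          \<open>j\<close>, so it does not matter if the window ends inside the block.\<close>
        have "(j div L) * L + (a + x) \<le> (j div L) * L + t" using x a(1) by linarith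
        also have "\<dots> = j" unfolding t_def by simp
        finally show "dist_int (g (s + a + x) - g (s' + a + x)) \<le> \<theta> / 3"
          using g j unfolding s_def s'_def by (metis (no_types, lifting) add.assoc le_less_trans)
      qed (use jet_eq[OF a(2)] err Ms in auto)
      also have "\<dots> \<le> \<theta> * real L ^ k"
        using t a(1) \<theta> by (intro mult_left_mono power_mono) auto
      finally show ?thesis using a(1) mj by simp
    qed
    obtain i1 i2 where i: "\<And>n. s \<le> n \<Longrightarrow> n < s + c s \<Longrightarrow> f n = fs i1 n"
      "\<And>n. s + c s \<le> n \<Longrightarrow> n < s + L \<Longrightarrow> f n = fs i2 n"
      using c(2)[OF Ms(1)] unfolding good_def by blast
    obtain i1' i2' where i': "\<And>n. s' \<le> n \<Longrightarrow> n < s' + c s \<Longrightarrow> f n = fs i1' n"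
      "\<And>n. s' + c s \<le> n \<Longrightarrow> n < s' + L \<Longrightarrow> f n = fs i2' n"
      using c(2)[OF Ms(2)] unfolding good_def cs by blast
    show "dist_int (f (m + j) - f (m' + j)) \<le> \<theta> * real L ^ k"
    proof (cases "t < c s")
      case True
      then show ?thesis using jets(1) i(1) i'(1) by (intro piece[of 0 i1 i1']) auto
    next
      case False
      then show ?thesis using jets(2) i(2) i'(2) t by (intro piece[of "c s" i2 i2']) auto
    qed
  next
    show "\<forall>j<n. dist_int (f (m + j) - f (m + j)) \<le> \<theta> * real L ^ k" for n m
      using \<theta> by (simp add: dist_int_def)
  qed
qed

text \<open>Rounding to precision \<open>L\<^sup>-\<^sup>k\<close> costs only \<open>O(ln L)\<close> per block of length \<open>L\<close>.\<close>
lemma block_code_rate_small: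
  fixes q k :: nat
  assumes "0 < q" "0 < \<eta>"
  obtains L where "0 < L" "ln (real ((L + 1) * ((q * L ^ k) ^ k * (q * L ^ k) ^ k))) / real L \<le> \<eta>"
proof -
  \<comment> \<open>By \<open>L + 1 \<le> 2 * L\<close>, the logarithm of the number of block codes
    is at most \<open>A * ln L + B\<close>.\<close>
  define A where "A = 1 + 2 * real k * real k"
  define B where "B = ln 2 + 2 * real k * ln (real q)"
  have "(\<lambda>L. A * (ln (real L) / real L) + B * (1 / real L)) \<longlonglongrightarrow> A * 0 + B * 0"
    by (intro tendsto_intros lim_ln_over_n lim_1_over_n)
  then have "\<forall>\<^sub>F L in sequentially. A * (ln (real L) / real L) + B * (1 / real L) < \<eta>"
    using assms(2) by (intro order_tendstoD(2)) auto
  then have "\<forall>\<^sub>F L in sequentially. A * (ln (real L) / real L) + B * (1 / real L) < \<eta> \<and> 0 < L"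
    using eventually_gt_at_top by (rule eventually_conj)
  then obtain L where L: "A * (ln (real L) / real L) + B * (1 / real L) < \<eta>" "0 < L"
    using eventually_happens by fastforce
  have "real ((L + 1) * ((q * L ^ k) ^ k * (q * L ^ k) ^ k)) = real (L + 1) * (real q * real L ^ k) ^ (2 * k)"
    by (simp only: of_nat_mult of_nat_power mult_2 power_add)
  also have "ln \<dots> = ln (real (L + 1)) + real (2 * k) * (ln (real q) + real k * ln (real L))"
    using L(2) assms(1) by (subst ln_mult, simp, simp, subst ln_realpow, simp, subst ln_mult, simp, simp, subst ln_realpow) simp_all
  also have "ln (real (L + 1)) \<le> ln (2 * real L)" using L(2) by (intro ln_mono) auto
  also have "ln (2 * real L) = ln 2 + ln (real L)" using L(2) by (simp add: ln_mult)
  finally have "ln (real ((L + 1) * ((q * L ^ k) ^ k * (q * L ^ k) ^ k))) \<le> A * ln (real L) + B"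
    by (simp add: A_def B_def algebra_simps)
  then have "ln (real ((L + 1) * ((q * L ^ k) ^ k * (q * L ^ k) ^ k))) / real L \<le> (A * ln (real L) + B) / real L"
    by (rule divide_right_mono) simp
  also have "\<dots> \<le> \<eta>" using L(1) by (simp add: add_divide_distrib)
  finally show thesis using that L(2) by blast
qed

section \<open>Choice of the precisions and the block length\<close>

theorem theorem1p4:
  fixes w :: nat
    and p :: "nat \<Rightarrow> real poly"
    and S :: "nat \<Rightarrow> nat set"
    and g :: "nat \<Rightarrow> real"
    and fs :: "nat \<Rightarrow> nat \<Rightarrow> real"
    and k :: nat
    and N :: "nat \<Rightarrow> nat"
    and f :: "nat \<Rightarrow> real"
  assumes "w \<ge> 1"
    and "(\<Union>v\<in>{1..w}. S v) = UNIV"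
    and "disjoint_family_on S {1..w}"
    and "\<And>v. v \<in> {1..w} \<Longrightarrow> deterministic TYPE('a) (indicator (S v))"
    and "\<And>n. g n = (\<Sum>v=1..w. indicator (S v) n * poly (p v) (real n))"
    and "(\<lambda>n. SUP i. dist_int ((fwd_diff ^^ k) (fs i) n - g n)) \<longlonglongrightarrow> 0"
    and "admissible_seq N"
    and "is_concatenation fs N f"
  shows "deterministic TYPE(nat \<Rightarrow> complex) (\<lambda>n. e (f n))"
proof (rule deterministic_if_codable)
  show "bounded (range (\<lambda>n. e (f n)))" by (auto simp: bounded_iff)
next
  fix \<epsilon> \<eta> :: real assume "0 < \<epsilon>" "0 < \<eta>"
  \<comment> \<open>The precision modulo 1 that \<open>e\<close>, having Lipschitz constant
    \<open>2 * pi\<close>, turns into \<open>\<epsilon>\<close>.\<close>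
  define \<delta> where "\<delta> = \<epsilon> / (2 * pi)"
  have \<delta>: "0 < \<delta>" using \<open>0 < \<epsilon>\<close> by (simp add: \<delta>_def)
  \<comment> \<open>As \<open>q\<close> depends on \<open>\<delta>\<close> alone, \<open>L\<close>
    can be chosen after it; \<open>q * L ^ k\<close> rounding cells then give precision
    \<open>\<theta>\<close>.\<close>
  define q where "q = Suc (nat \<lceil>1 / \<delta>\<rceil>)"
  have q: "0 < q" "1 / \<delta> \<le> q" unfolding q_def by linarith+
  obtain L where L: "0 < L" "ln (real ((L + 1) * ((q * L ^ k) ^ k * (q * L ^ k) ^ k))) / real L \<le> \<eta> / 2"
    using block_code_rate_small[OF q(1), of "\<eta> / 2"] \<open>0 < \<eta>\<close> by auto
  \<comment> \<open>Errors may grow by the factor \<open>L ^ k\<close> within a block.\<close>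
  define \<theta> where "\<theta> = \<delta> / real L ^ k"
  have \<theta>: "0 < \<theta>" using \<delta> L(1) by (simp add: \<theta>_def)
  \<comment> \<open>The rate left for coding \<open>g\<close> once the block codes are paid for; it
    is at least \<open>\<eta> / 2\<close>.\<close>
  define \<eta>' where "\<eta>' = \<eta> - ln (real ((L + 1) * ((q * L ^ k) ^ k * (q * L ^ k) ^ k))) / real L"
  have \<eta>': "0 < \<eta>'" using L(2) \<open>0 < \<eta>\<close> unfolding \<eta>'_def by linarith
  obtain M where M: "\<And>s. M \<le> s \<Longrightarrow> \<exists>c\<le>L. (\<exists>i. \<forall>n. s \<le> n \<longrightarrow> n < s + c \<longrightarrow> f n = fs i n) \<and>
      (\<exists>i. \<forall>n. s + c \<le> n \<longrightarrow> n < s + L \<longrightarrow> f n = fs i n)"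
    using concatenation_single_breakpoint[OF assms(7,8)] by blast
  have "\<forall>\<^sub>F n in sequentially. (SUP i. dist_int ((fwd_diff ^^ k) (fs i) n - g n)) < \<theta> / 3"
    using assms(6) \<theta> by (intro order_tendstoD(2)) auto
  then obtain M' where M': "\<And>n. M' \<le> n \<Longrightarrow> (SUP i. dist_int ((fwd_diff ^^ k) (fs i) n - g n)) < \<theta> / 3"
    unfolding eventually_sequentially by blast
  have err: "dist_int ((fwd_diff ^^ k) (fs i) n - g n) \<le> \<theta> / 3" if "max M M' \<le> n" for i n
  proof -
    \<comment> \<open>A real supremum bounds its terms only if they are bounded above; here they are
      at most \<open>1 / 2\<close>.\<close>
    have "bdd_above (range (\<lambda>i. dist_int ((fwd_diff ^^ k) (fs i) n - g n)))"
      using dist_int_le_half by (intro bdd_aboveI2)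
    then have "dist_int ((fwd_diff ^^ k) (fs i) n - g n) \<le> (SUP i. dist_int ((fwd_diff ^^ k) (fs i) n - g n))"
      by (intro cSUP_upper) auto
    with M'[of n] that show ?thesis by simp
  qed
  have "codable_at_rate \<eta>' (\<lambda>n m m'. \<forall>j<n. dist_int (g (m + j) - g (m' + j)) \<le> \<theta> / 3)"
    by (rule codable_at_rate_partition_poly[OF _ assms(2,3) codable_at_rate_deterministic[OF assms(4)] assms(5)])
      (use \<theta> \<eta>' in auto)
  moreover have "1 / real (q * L ^ k) \<le> \<theta>"
    using q L(1) \<delta> by (simp add: \<theta>_def field_simps)
  ultimately have "codable_at_rate (\<eta>' + ln (real ((L + 1) * ((q * L ^ k) ^ k * (q * L ^ k) ^ k))) / real L)
      (\<lambda>n m m'. \<forall>j<n. dist_int (f (m + j) - f (m' + j)) \<le> \<theta> * real L ^ k)"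
    using L(1) q(1) M err by (intro codable_at_rate_concatenation[where M = "max M M'" and fs = fs and g = g]) auto
  then have "codable_at_rate \<eta> (\<lambda>n m m'. \<forall>j<n. dist_int (f (m + j) - f (m' + j)) \<le> \<delta>)"
    using L(1) by (simp add: \<eta>'_def \<theta>_def)
  then show "codable_at_rate \<eta> (\<lambda>n m m'. \<forall>j<n. dist (e (f (m + j))) (e (f (m' + j))) \<le> \<epsilon>)"
  proof (rule codable_at_rate_mono, intro allI impI)
    fix n m m' j :: nat
    assume "\<forall>j<n. dist_int (f (m + j) - f (m' + j)) \<le> \<delta>" "j < n"
    then have "2 * pi * dist_int (f (m + j) - f (m' + j)) \<le> 2 * pi * \<delta>"
      by (intro mult_left_mono) auto
    then show "dist (e (f (m + j))) (e (f (m' + j))) \<le> \<epsilon>"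
      using norm_e_diff_le[of "f (m + j)" "f (m' + j)"] by (simp add: dist_norm \<delta>_def)
  qed
qed

end
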